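(* The data $(\mathcal{G},\mathrm{s},\mathrm{t},\mathrm{m},\mathrm{u},\mathrm{i})$ given in the context define a $\mathrm{G}_2$-equivariant Lie groupoid $\mathcal{G}\Rightarrow\mathbb{O}^2$, whose orbits are the leaves of the singular octonionic Hopf leaf decomposition $\mathcal{L}_{OH}$.
   Context: $\mathbb{O}\cong\mathbb{R}^8$ denotes the octonions: the real unital non-associative algebra with orthonormal basis $e_0=1,e_1,\dots,e_7$ and $e_i\cdot e_j=-\delta_{ij}1+\sum_k\epsilon_{ijk}e_k$ for $1\le i,j\le 7$, where $\epsilon_{ijk}$ is completely antisymmetric, equal to $1$ for $ijk\in\{123,145,176,246,257,347,365\}$, and $0$ for all triples that are not permutations of these; $\langle\cdot,\cdot\rangle$, $\|\cdot\|$ are the Euclidean inner product and norm and $\overline{a}=2\langle a,1\rangle 1-a$ is conjugation. $\mathcal{L}_{OH}$: for $m\in\mathbb{O}$ let $l_m=\{(x,m\cdot x):x\in\mathbb{O}\}$ and let $l_\infty=\{(0,x):x\in\mathbb{O}\}$. For $r>0$ let $\mathrm{S}(r)=\{(x,y)\in\mathbb{O}^2:\|x\|^2+\|y\|^2=r^2\}$. The leaves of $\mathcal{L}_{OH}$ are $l_m\cap \mathrm{S}(r)$, $l_\infty\cap \mathrm{S}(r)$ ($m\in\mathbb{O}$, $r>0$), and the origin. Rescaling function $\lambda:\mathbb{O}^2\times\mathbb{O}^2\to\mathbb{R}$: $$\lambda(F,G,x,y)=\sqrt{1+2\left(\langle x,F\rangle+\langle y,G\rangle+\langle x\cdot\overline{y},F\cdot\overline{G}\rangle\right)+\|x\|^2\|F\|^2+\|y\|^2\|G\|^2}$$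 (the radicand is non-negative). Data: the manifold of arrows is $\mathcal{G}=\{(F,G,x,y)\in\mathbb{O}^2\times\mathbb{O}^2:\lambda(F,G,x,y)\neq0\}$. For $g=(F,G,x,y)\in\mathcal{G}$: source $\mathrm{s}(g)=(x,y)$; target $$\mathrm{t}(g)=\frac{1}{\lambda(g)}\left(x+\|x\|^2F+(x\cdot\overline{y})\cdot G,\ y+\|y\|^2G+(y\cdot\overline{x})\cdot F\right).$$ For $g'=(F',G',x',y')$ and $g=(F,G,x,y)$ with $\mathrm{s}(g')=\mathrm{t}(g)$, the product is $\mathrm{m}(g',g)=g'\cdot g=(F+\lambda(g)F',G+\lambda(g)G',x,y)$. Unit: $\mathrm{u}(x,y)=1_{(x,y)}=(0,0,x,y)$. Inverse: $\mathrm{i}(g)=g^{-1}=(-F/\lambda(g),-G/\lambda(g),\mathrm{t}(g))$. $\mathrm{G}_2$ is the automorphism group of the algebra $\mathbb{O}$, acting component-wise on $\mathbb{O}^2$ and on $\mathbb{O}^2\times\mathbb{O}^2$. $\mathrm{G}_2$-equivariance of $\mathcal{G}$ means that $\mathcal{G}$ is preserved by this action and all structure maps of the groupoid are equivariant. The orbits of $\mathcal{G}$ are the equivalence classes of the relation $\mathrm{s}(g)\sim\mathrm{t}(g)$, $g\in\mathcal{G}$. *)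

theory Defs
  imports "HOL-Analysis.Analysis"
begin

section \<open>Octonions\<close>

text \<open>
  Coordinates are indexed by the eight elements 0, ..., 7 of the numeral type 8.
  The componentwise multiplication and unit that the library puts on \<open>real ^ 8\<close>
  are not the octonionic ones and are never used; the inner product and norm are.
\<close>

type_synonym octonion = "real ^ 8"

definition oct_basis :: "8 \<Rightarrow> octonion" where
  "oct_basis i = axis i 1"

definition oct_triples :: "(8 \<times> 8 \<times> 8) set" where
  "oct_triples = {(1,2,3), (1,4,5), (1,7,6), (2,4,6), (2,5,7), (3,4,7), (3,6,5)}"

definition oct_cyclic :: "(8 \<times> 8 \<times> 8) set" where
  "oct_cyclic = {(i,j,k). (i,j,k) \<in> oct_triples \<or> (j,k,i) \<in> oct_triples \<or> (k,i,j) \<in> oct_triples}"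

definition oct_eps :: "8 \<Rightarrow> 8 \<Rightarrow> 8 \<Rightarrow> real" where
  "oct_eps i j k =
     (if (i,j,k) \<in> oct_cyclic then 1 else if (j,i,k) \<in> oct_cyclic then - 1 else 0)"

lemma oct_cyclic_rotate: "(i,j,k) \<in> oct_cyclic \<longleftrightarrow> (j,k,i) \<in> oct_cyclic"
  by (auto simp: oct_cyclic_def)

lemma oct_cyclic_swap: "(i,j,k) \<in> oct_cyclic \<Longrightarrow> (j,i,k) \<notin> oct_cyclic"
proof -
  have "\<forall>(a,b,c)\<in>oct_triples.
      (b,a,c) \<notin> oct_triples \<and> (a,c,b) \<notin> oct_triples \<and> (c,b,a) \<notin> oct_triples"
    by (simp add: oct_triples_def)
  then show "(i,j,k) \<in> oct_cyclic \<Longrightarrow> (j,i,k) \<notin> oct_cyclic"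
    unfolding oct_cyclic_def by blast
qed

lemma oct_eps_swap12: "oct_eps j i k = - oct_eps i j k"
  using oct_cyclic_swap by (auto simp: oct_eps_def)

lemma oct_eps_swap23: "oct_eps i k j = - oct_eps i j k"
proof -
  have rotate: "oct_eps a b c = oct_eps b c a" for a b c
    using oct_cyclic_rotate[of a b c] oct_cyclic_rotate[of b a c] oct_cyclic_rotate[of a c b]
    by (simp add: oct_eps_def)
  show ?thesis
    using rotate[of i k j] oct_eps_swap12[of j k i] rotate[of i j k] by simp
qed

definition oct_basis_mult :: "8 \<Rightarrow> 8 \<Rightarrow> octonion" where
  "oct_basis_mult i j =
     (if i = 0 then oct_basis j
      else if j = 0 then oct_basis i
      else - (if i = j then oct_basis 0 else 0)
           + (\<Sum>k\<in>UNIV - {0}. oct_eps i j k *\<^sub>R oct_basis k))"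

definition oct_mult :: "octonion \<Rightarrow> octonion \<Rightarrow> octonion" (infixl "\<odot>" 70) where
  "x \<odot> y = (\<Sum>i\<in>UNIV. \<Sum>j\<in>UNIV. (x $ i * y $ j) *\<^sub>R oct_basis_mult i j)"

lemma oct_mult_basis: "oct_basis i \<odot> oct_basis j = oct_basis_mult i j"
proof -
  have "(oct_basis i $ a * oct_basis j $ b) *\<^sub>R oct_basis_mult a b
      = (if b = j then if a = i then oct_basis_mult a b else 0 else 0)" for a b
    by (simp add: oct_basis_def axis_def)
  then show ?thesis
    by (simp add: oct_mult_def)
qed

definition oct_one :: octonion where
  "oct_one = oct_basis 0"

definition oct_cnj :: "octonion \<Rightarrow> octonion" where
  "oct_cnj a = (2 * (a \<bullet> oct_one)) *\<^sub>R oct_one - a"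

definition G2 :: "(octonion \<Rightarrow> octonion) set" where
  "G2 = {\<phi>. linear \<phi> \<and> bij \<phi> \<and> (\<forall>x y. \<phi> (x \<odot> y) = \<phi> x \<odot> \<phi> y)}"


section \<open>Smooth maps\<close>

text \<open>
  For maps between finite-dimensional spaces and open \<open>U\<close>, \<open>Ck_on n U f\<close> says that \<open>f\<close> is
  \<open>n\<close> times continuously differentiable on \<open>U\<close>.
\<close>

primrec Ck_on ::
  "nat \<Rightarrow> 'a::euclidean_space set \<Rightarrow> ('a \<Rightarrow> 'b::euclidean_space) \<Rightarrow> bool" where
  "Ck_on 0 U f \<longleftrightarrow> continuous_on U f"
| "Ck_on (Suc n) U f \<longleftrightarrow>
     (\<forall>x\<in>U. f differentiable (at x)) \<and>
     (\<forall>v. Ck_on n U (\<lambda>x. frechet_derivative f (at x) v))"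

text \<open>
  Smoothness on an arbitrary subset means local extendability to smooth maps on open subsets
  of the ambient space. On open sets this is ordinary smoothness, and on embedded submanifolds
  (such as the set of composable pairs of a Lie groupoid) it is smoothness for the induced
  manifold structure.
\<close>

definition smooth_map_on ::
  "'a::euclidean_space set \<Rightarrow> ('a \<Rightarrow> 'b::euclidean_space) \<Rightarrow> bool" where
  "smooth_map_on S f \<longleftrightarrow>
     (\<forall>x\<in>S. \<exists>U h. open U \<and> x \<in> U \<and> (\<forall>n. Ck_on n U h) \<and> (\<forall>y\<in>S \<inter> U. h y = f y))"

definition submersion_on ::
  "'a::euclidean_space set \<Rightarrow> ('a \<Rightarrow> 'b::euclidean_space) \<Rightarrow> bool" where
  "submersion_on A f \<longleftrightarrow> (\<forall>x\<in>A. \<exists>D. (f has_derivative D) (at x) \<and> surj D)"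

section \<open>Lie groupoids\<close>

text \<open>
  Objects \<open>M\<close>, arrows \<open>A\<close>; the maps are only relevant on \<open>M\<close>, \<open>A\<close> and on the
  composable pairs, respectively.
\<close>

definition composable :: "'a set \<Rightarrow> ('a \<Rightarrow> 'b) \<Rightarrow> ('a \<Rightarrow> 'b) \<Rightarrow> ('a \<times> 'a) set" where
  "composable A s t = {(g', g). g' \<in> A \<and> g \<in> A \<and> s g' = t g}"

locale groupoid =
  fixes M :: "'b set" and A :: "'a set"
    and s t :: "'a \<Rightarrow> 'b" and m :: "'a \<times> 'a \<Rightarrow> 'a" and u :: "'b \<Rightarrow> 'a" and i :: "'a \<Rightarrow> 'a"
  assumes source_closed: "g \<in> A \<Longrightarrow> s g \<in> M"
    and target_closed: "g \<in> A \<Longrightarrow> t g \<in> M"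
    and mult_closed: "(g', g) \<in> composable A s t \<Longrightarrow> m (g', g) \<in> A"
    and unit_closed: "p \<in> M \<Longrightarrow> u p \<in> A"
    and inverse_closed: "g \<in> A \<Longrightarrow> i g \<in> A"
    and source_mult: "(g', g) \<in> composable A s t \<Longrightarrow> s (m (g', g)) = s g"
    and target_mult: "(g', g) \<in> composable A s t \<Longrightarrow> t (m (g', g)) = t g'"
    and mult_assoc:
      "(g'', g') \<in> composable A s t \<Longrightarrow> (g', g) \<in> composable A s t \<Longrightarrow>
        m (m (g'', g'), g) = m (g'', m (g', g))"
    and source_unit: "p \<in> M \<Longrightarrow> s (u p) = p"
    and target_unit: "p \<in> M \<Longrightarrow> t (u p) = p"
    and unit_right: "g \<in> A \<Longrightarrow> m (g, u (s g)) = g"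
    and unit_left: "g \<in> A \<Longrightarrow> m (u (t g), g) = g"
    and source_inverse: "g \<in> A \<Longrightarrow> s (i g) = t g"
    and target_inverse: "g \<in> A \<Longrightarrow> t (i g) = s g"
    and inverse_left: "g \<in> A \<Longrightarrow> m (i g, g) = u (s g)"
    and inverse_right: "g \<in> A \<Longrightarrow> m (g, i g) = u (t g)"

text \<open>
  Lie groupoids whose manifolds of objects and arrows are open submanifolds of Euclidean spaces.
\<close>

locale lie_groupoid = groupoid M A s t m u i
  for M :: "'b::euclidean_space set" and A :: "'a::euclidean_space set"
    and s t :: "'a \<Rightarrow> 'b" and m :: "'a \<times> 'a \<Rightarrow> 'a" and u :: "'b \<Rightarrow> 'a" and i :: "'a \<Rightarrow> 'a" +
  assumes open_objects: "open M"
    and open_arrows: "open A"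
    and smooth_source: "smooth_map_on A s"
    and smooth_target: "smooth_map_on A t"
    and smooth_mult: "smooth_map_on (composable A s t) m"
    and smooth_unit: "smooth_map_on M u"
    and smooth_inverse: "smooth_map_on A i"
    and submersion_source: "submersion_on A s"
    and submersion_target: "submersion_on A t"

definition groupoid_orbits :: "'b set \<Rightarrow> 'a set \<Rightarrow> ('a \<Rightarrow> 'b) \<Rightarrow> ('a \<Rightarrow> 'b) \<Rightarrow> 'b set set" where
  "groupoid_orbits M A s t = M // {(s g, t g) | g. g \<in> A}"

section \<open>The octonionic Hopf groupoid\<close>

type_synonym oct_point = "octonion \<times> octonion"

text \<open>The arrow \<open>(F, G, x, y)\<close> is encoded as \<open>((F, G), (x, y))\<close>.\<close>

type_synonym oct_arrow = "oct_point \<times> oct_point"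

fun rescaling :: "oct_arrow \<Rightarrow> real" where
  "rescaling ((F, G), (x, y)) =
     sqrt (1 + 2 * (x \<bullet> F + y \<bullet> G + (x \<odot> oct_cnj y) \<bullet> (F \<odot> oct_cnj G))
             + (norm x)\<^sup>2 * (norm F)\<^sup>2 + (norm y)\<^sup>2 * (norm G)\<^sup>2)"

definition oh_arrows :: "oct_arrow set" where
  "oh_arrows = {g. rescaling g \<noteq> 0}"

fun oh_source :: "oct_arrow \<Rightarrow> oct_point" where
  "oh_source ((F, G), (x, y)) = (x, y)"

fun oh_target :: "oct_arrow \<Rightarrow> oct_point" where
  "oh_target ((F, G), (x, y)) =
     (1 / rescaling ((F, G), (x, y))) *\<^sub>R
       (x + (norm x)\<^sup>2 *\<^sub>R F + (x \<odot> oct_cnj y) \<odot> G,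
        y + (norm y)\<^sup>2 *\<^sub>R G + (y \<odot> oct_cnj x) \<odot> F)"

fun oh_mult :: "oct_arrow \<times> oct_arrow \<Rightarrow> oct_arrow" where
  "oh_mult (((F', G'), (x', y')), ((F, G), (x, y))) =
     ((F + rescaling ((F, G), (x, y)) *\<^sub>R F', G + rescaling ((F, G), (x, y)) *\<^sub>R G'), (x, y))"

fun oh_unit :: "oct_point \<Rightarrow> oct_arrow" where
  "oh_unit (x, y) = ((0, 0), (x, y))"

fun oh_inverse :: "oct_arrow \<Rightarrow> oct_arrow" where
  "oh_inverse ((F, G), (x, y)) =
     ((- F /\<^sub>R rescaling ((F, G), (x, y)), - G /\<^sub>R rescaling ((F, G), (x, y))),
      oh_target ((F, G), (x, y)))"

section \<open>Equivariance\<close>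

definition G2_point :: "(octonion \<Rightarrow> octonion) \<Rightarrow> oct_point \<Rightarrow> oct_point" where
  "G2_point \<phi> = map_prod \<phi> \<phi>"

definition G2_arrow :: "(octonion \<Rightarrow> octonion) \<Rightarrow> oct_arrow \<Rightarrow> oct_arrow" where
  "G2_arrow \<phi> = map_prod (G2_point \<phi>) (G2_point \<phi>)"

definition G2_equivariant ::
  "oct_point set \<Rightarrow> oct_arrow set \<Rightarrow> (oct_arrow \<Rightarrow> oct_point) \<Rightarrow> (oct_arrow \<Rightarrow> oct_point) \<Rightarrow>
   (oct_arrow \<times> oct_arrow \<Rightarrow> oct_arrow) \<Rightarrow> (oct_point \<Rightarrow> oct_arrow) \<Rightarrow>
   (oct_arrow \<Rightarrow> oct_arrow) \<Rightarrow> bool" where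
  "G2_equivariant M A s t m u i \<longleftrightarrow>
     (\<forall>\<phi>\<in>G2.
        G2_point \<phi> ` M = M \<and> G2_arrow \<phi> ` A = A \<and>
        (\<forall>g\<in>A. s (G2_arrow \<phi> g) = G2_point \<phi> (s g)) \<and>
        (\<forall>g\<in>A. t (G2_arrow \<phi> g) = G2_point \<phi> (t g)) \<and>
        (\<forall>(g', g)\<in>composable A s t.
           m (G2_arrow \<phi> g', G2_arrow \<phi> g) = G2_arrow \<phi> (m (g', g))) \<and>
        (\<forall>p\<in>M. u (G2_point \<phi> p) = G2_arrow \<phi> (u p)) \<and>
        (\<forall>g\<in>A. i (G2_arrow \<phi> g) = G2_arrow \<phi> (i g)))"

section \<open>The octonionic Hopf leaf decomposition\<close>

definition oct_line :: "octonion \<Rightarrow> oct_point set" where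
  "oct_line m = {(x, m \<odot> x) | x. True}"

definition oct_line_inf :: "oct_point set" where
  "oct_line_inf = {(0, x) | x. True}"

definition oct_sphere :: "real \<Rightarrow> oct_point set" where
  "oct_sphere r = {(x, y). (norm x)\<^sup>2 + (norm y)\<^sup>2 = r\<^sup>2}"

definition OH_leaves :: "oct_point set set" where
  "OH_leaves =
     {oct_line m \<inter> oct_sphere r | m r. r > 0}
     \<union> {oct_line_inf \<inter> oct_sphere r | r. r > 0}
     \<union> {{(0, 0)}}"

end

theory Submission
  imports Defs
begin

text \<open>
  The base point \<open>p\<close> of an arrow \<open>(f, p)\<close> with \<open>f = (F, G)\<close> lies on some line \<open>l\<^sub>m\<close> or
  \<open>l\<^sub>\<infinity>\<close>, say \<open>p = L x\<close> where \<open>L\<close> is \<open>z \<mapsto> (z, m z)\<close> or \<open>z \<mapsto> (0, z)\<close>. With \<open>v = Q f\<close>,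
  where \<open>Q\<close> is the adjoint of \<open>L\<close>, that is, \<open>v = F + cnj(m) G\<close> or \<open>v = G\<close>, alternativity
  shows that \<open>\<lambda>\<^sup>2 = 1 + 2\<langle>x, v\<rangle> + |x|\<^sup>2|v|\<^sup>2\<close> and that the target is \<open>L x'\<close> with
  \<open>\<lambda> x' = x + |x|\<^sup>2 v\<close>. Hence \<open>|x'| = |x|\<close>, the function \<open>\<lambda>\<close> is multiplicative, and every
  \<open>x'\<close> with \<open>|x'| = |x|\<close> is reached with \<open>\<lambda> = 1\<close>. The target is the source after the
  inversion, an involutive diffeomorphism, hence a submersion. Equivariance follows because
  \<open>a\<^sup>2 - 2\<langle>a, 1\<rangle>a + |a|\<^sup>2 = 0\<close> forces automorphisms to preserve conjugation and inner product.
\<close>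

section \<open>Octonionic identities\<close>

lemma UNIV_8: "(UNIV :: 8 set) = {0, 1, 2, 3, 4, 5, 6, 7}"
  by (rule sym, rule card_subset_eq) simp_all

lemma sum_8: "sum f (UNIV :: 8 set) = f 0 + f 1 + f 2 + f 3 + f 4 + f 5 + f 6 + f 7"
  for f :: "8 \<Rightarrow> 'a::comm_monoid_add"
  unfolding UNIV_8 by simp (simp only: add.assoc)

lemma forall_8: "(\<forall>i::8. P i) \<longleftrightarrow> P 0 \<and> P 1 \<and> P 2 \<and> P 3 \<and> P 4 \<and> P 5 \<and> P 6 \<and> P 7"
  by (metis UNIV_8 UNIV_I insertE singletonD)

lemma oct_basis_nth: "oct_basis i $ k = (if i = k then 1 else 0)"
  by (simp add: oct_basis_def axis_def)

text \<open>Turns each structure constant into a case distinction, so that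
  \<open>oct_mult_nth\<close> follows by evaluating the finite table
  \<open>oct_triples\<close>.\<close>

lemma oct_basis_mult_nth:
  "oct_basis_mult i j $ k =
     (if i = 0 then if j = k then 1 else 0
      else if j = 0 then if i = k then 1 else 0
      else if k = 0 then if i = j then - 1 else 0
      else oct_eps i j k)"
proof -
  have "(\<Sum>l\<in>UNIV - {0}. oct_eps i j l * oct_basis l $ k)
      = (\<Sum>l\<in>UNIV - {0}. if l = k then oct_eps i j l else 0)"
    by (rule sum.cong) (simp_all add: oct_basis_nth)
  also have "\<dots> = (if k = 0 then 0 else oct_eps i j k)"
    by simp
  finally show ?thesis
    by (cases "k = 0") (simp_all add: oct_basis_mult_def oct_basis_nth del: sum.delta sum_mult_of_bool_eq)
qed

lemma oct_mult_nth:
  "(x \<odot> y) $ 0 = x$0*y$0 - x$1*y$1 - x$2*y$2 - x$3*y$3 - x$4*y$4 - x$5*y$5 - x$6*y$6 - x$7*y$7"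
  "(x \<odot> y) $ 1 = x$0*y$1 + x$1*y$0 + x$2*y$3 - x$3*y$2 + x$4*y$5 - x$5*y$4 + x$7*y$6 - x$6*y$7"
  "(x \<odot> y) $ 2 = x$0*y$2 + x$2*y$0 + x$3*y$1 - x$1*y$3 + x$4*y$6 - x$6*y$4 + x$5*y$7 - x$7*y$5"
  "(x \<odot> y) $ 3 = x$0*y$3 + x$3*y$0 + x$1*y$2 - x$2*y$1 + x$4*y$7 - x$7*y$4 + x$6*y$5 - x$5*y$6"
  "(x \<odot> y) $ 4 = x$0*y$4 + x$4*y$0 + x$5*y$1 - x$1*y$5 + x$6*y$2 - x$2*y$6 + x$7*y$3 - x$3*y$7"
  "(x \<odot> y) $ 5 = x$0*y$5 + x$5*y$0 + x$1*y$4 - x$4*y$1 + x$7*y$2 - x$2*y$7 + x$3*y$6 - x$6*y$3"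
  "(x \<odot> y) $ 6 = x$0*y$6 + x$6*y$0 + x$1*y$7 - x$7*y$1 + x$2*y$4 - x$4*y$2 + x$5*y$3 - x$3*y$5"
  "(x \<odot> y) $ 7 = x$0*y$7 + x$7*y$0 + x$6*y$1 - x$1*y$6 + x$2*y$5 - x$5*y$2 + x$3*y$4 - x$4*y$3"
  by (simp_all add: oct_mult_def sum_8 oct_basis_mult_nth oct_eps_def oct_cyclic_def oct_triples_def)

lemma oct_one_nth: "oct_one $ i = (if i = 0 then 1 else 0)"
  by (simp add: oct_one_def oct_basis_def axis_def)

lemma inner_8: "x \<bullet> y = x$0*y$0 + x$1*y$1 + x$2*y$2 + x$3*y$3 + x$4*y$4 + x$5*y$5 + x$6*y$6 + x$7*y$7"
  for x y :: octonion
  by (simp add: inner_vec_def sum_8)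

lemma inner_oct_one: "x \<bullet> oct_one = x $ 0"
  by (simp add: inner_8 oct_one_nth)

lemma oct_cnj_nth: "oct_cnj x $ i = (if i = 0 then x $ i else - (x $ i))"
  by (auto simp: oct_cnj_def inner_oct_one oct_one_nth)

section \<open>Conjugation, adjoints, alternativity and multiplicativity of the norm\<close>

lemma oct_cnj_mult: "oct_cnj (x \<odot> y) = oct_cnj y \<odot> oct_cnj x"
  unfolding vec_eq_iff forall_8 by (simp add: oct_mult_nth oct_cnj_nth)

lemma oct_cnj_cnj [simp]: "oct_cnj (oct_cnj x) = x"
  by (simp add: vec_eq_iff oct_cnj_nth)

lemma inner_oct_cnj: "oct_cnj x \<bullet> oct_cnj y = x \<bullet> y"
  by (simp add: inner_8 oct_cnj_nth)

lemma norm_oct_cnj [simp]: "norm (oct_cnj x) = norm x"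
  by (simp add: norm_eq_sqrt_inner inner_oct_cnj)

lemma linear_oct_cnj: "linear oct_cnj"
  by (rule linearI) (simp_all add: vec_eq_iff oct_cnj_nth)

lemma bilinear_oct_mult: "bilinear (\<odot>)"
  unfolding bilinear_def by (auto intro!: linearI
      simp: oct_mult_def algebra_simps sum.distrib scaleR_sum_right)

text \<open>A polynomial identity in coordinates. Together with \<open>inner_oct_mult_right\<close>
  it moves factors across the inner product without appeal to associativity.\<close>

lemma inner_oct_mult_left: "(x \<odot> y) \<bullet> z = y \<bullet> (oct_cnj x \<odot> z)"
  by (simp add: oct_mult_nth oct_cnj_nth inner_8) algebra

text \<open>The form in which alternativity is used: the subalgebra generated by two octonions is
  associative, so x and its conjugate may be multiplied first.\<close>

lemma oct_mult_cnj_cancel_left: "x \<odot> (oct_cnj x \<odot> y) = (norm x)\<^sup>2 *\<^sub>R y"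
  unfolding vec_eq_iff forall_8 power2_norm_eq_inner
  by (simp add: oct_mult_nth oct_cnj_nth inner_8, intro conjI; algebra)

lemma oct_mult_linear:
  "linear (\<lambda>x. x \<odot> y)" "linear (\<lambda>y. x \<odot> y)"
  using bilinear_oct_mult by (simp_all add: bilinear_def)

lemma oct_mult_scaleR [simp]: "(c *\<^sub>R x) \<odot> y = c *\<^sub>R (x \<odot> y)" "x \<odot> (c *\<^sub>R y) = c *\<^sub>R (x \<odot> y)"
  by (simp_all add: oct_mult_linear[THEN linear_scale])

lemma oct_mult_add: "(x + y) \<odot> z = x \<odot> z + y \<odot> z" "x \<odot> (y + z) = x \<odot> y + x \<odot> z"
  by (simp_all add: linear_add[OF oct_mult_linear(1)] linear_add[OF oct_mult_linear(2)])

lemma oct_mult_zero [simp]: "0 \<odot> y = 0" "x \<odot> 0 = 0"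
  by (simp_all add: oct_mult_linear[THEN linear_0])

lemma oct_cnj_scaleR [simp]: "oct_cnj (c *\<^sub>R x) = c *\<^sub>R oct_cnj x"
  by (simp add: linear_oct_cnj linear_scale)

lemma oct_cnj_zero [simp]: "oct_cnj 0 = 0"
  by (simp add: linear_oct_cnj linear_0)

lemma oct_mult_one [simp]: "oct_one \<odot> x = x" "x \<odot> oct_one = x"
  unfolding vec_eq_iff forall_8 by (simp_all add: oct_mult_nth oct_one_nth)

text \<open>The mirror image of \<open>oct_mult_cnj_cancel_left\<close>, since conjugation reverses
  products.\<close>

lemma oct_mult_cnj_cancel_right: "(y \<odot> x) \<odot> oct_cnj x = (norm x)\<^sup>2 *\<^sub>R y"
proof -
  have "oct_cnj ((y \<odot> x) \<odot> oct_cnj x) = oct_cnj ((norm x)\<^sup>2 *\<^sub>R y)"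
    by (simp only: oct_cnj_mult oct_cnj_cnj oct_mult_cnj_cancel_left oct_cnj_scaleR)
  then show ?thesis
    using oct_cnj_cnj by metis
qed

lemma inner_oct_mult_right: "(x \<odot> y) \<bullet> z = x \<bullet> (z \<odot> oct_cnj y)"
  using inner_oct_mult_left[of "oct_cnj y" "oct_cnj x" "oct_cnj z"]
  by (metis inner_oct_cnj oct_cnj_cnj oct_cnj_mult)

text \<open>Moving the left factor across in <xy, xy> leaves <y, cnj(x)(xy)>, where x
  cancels.\<close>

lemma norm_oct_mult: "norm (x \<odot> y) = norm x * norm y"
proof -
  have "(norm (x \<odot> y))\<^sup>2 = (norm x * norm y)\<^sup>2"
    using oct_mult_cnj_cancel_left[of "oct_cnj x" y]
    by (simp add: power2_norm_eq_inner[of "x \<odot> y"] inner_oct_mult_left power_mult_distrib)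
      (simp add: power2_norm_eq_inner)
  then show ?thesis
    by simp
qed

lemma oct_square: "x \<odot> x = (2 * (x \<bullet> oct_one)) *\<^sub>R x - (norm x)\<^sup>2 *\<^sub>R oct_one"
  unfolding vec_eq_iff forall_8 power2_norm_eq_inner
  by (simp add: oct_mult_nth oct_one_nth inner_8)

section \<open>The Hopf groupoid\<close>

text \<open>\<open>radicand\<close> and \<open>displacement\<close> are the polynomial parts of
  \<open>rescaling\<close> and \<open>oh_target\<close>, freed from the root and the quotient, so
  that their identities and smoothness hold on the whole space.\<close>

definition radicand :: "oct_arrow \<Rightarrow> real" where
  "radicand = (\<lambda>((F, G), (x, y)).
     1 + 2 * (x \<bullet> F + y \<bullet> G + (x \<odot> oct_cnj y) \<bullet> (F \<odot> oct_cnj G))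
       + (norm x)\<^sup>2 * (norm F)\<^sup>2 + (norm y)\<^sup>2 * (norm G)\<^sup>2)"

definition displacement :: "oct_arrow \<Rightarrow> oct_point" where
  "displacement = (\<lambda>((F, G), (x, y)).
     (x + (norm x)\<^sup>2 *\<^sub>R F + (x \<odot> oct_cnj y) \<odot> G, y + (norm y)\<^sup>2 *\<^sub>R G + (y \<odot> oct_cnj x) \<odot> F))"

lemma rescaling_eq: "rescaling g = sqrt (radicand g)"
  by (cases g rule: rescaling.cases) (simp add: radicand_def)

lemma oh_source_eq: "oh_source g = snd g"
  by (cases g rule: rescaling.cases) simp

lemma oh_target_eq: "oh_target g = (1 / rescaling g) *\<^sub>R displacement g"
  by (cases g rule: rescaling.cases) (simp add: displacement_def)

lemma oh_mult_eq: "oh_mult (g', g) = (fst g + rescaling g *\<^sub>R fst g', snd g)"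
  by (cases g rule: rescaling.cases, cases g' rule: rescaling.cases) simp

lemma oh_unit_eq: "oh_unit p = (0, p)"
  by (cases p) (simp add: zero_prod_def)

lemma oh_inverse_eq: "oh_inverse g = ((- (1 / rescaling g)) *\<^sub>R fst g, oh_target g)"
  by (cases g rule: rescaling.cases) (simp add: inverse_eq_divide)

text \<open>
  Here \<open>Q\<close> is the adjoint of the embedding \<open>L\<close> of a line through the origin. No octonionic
  product is left on the right-hand sides, so that the groupoid identities on the line become
  identities in a real inner product space.
\<close>

definition line_chart :: "(octonion \<Rightarrow> oct_point) \<Rightarrow> (oct_point \<Rightarrow> octonion) \<Rightarrow> bool" where
  "line_chart L Q \<longleftrightarrow> linear L \<and> linear Q \<and> surj Q \<and>
     (\<forall>x f. displacement (f, L x) = L (x + (norm x)\<^sup>2 *\<^sub>R Q f)) \<and>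
     (\<forall>x f. radicand (f, L x) = 1 + 2 * (x \<bullet> Q f) + (norm x)\<^sup>2 * (norm (Q f))\<^sup>2)"

lemma line_chartD:
  assumes "line_chart L Q"
  shows "linear L" "linear Q" "surj Q"
    and "displacement (f, L x) = L (x + (norm x)\<^sup>2 *\<^sub>R Q f)"
    and "radicand (f, L x) = 1 + 2 * (x \<bullet> Q f) + (norm x)\<^sup>2 * (norm (Q f))\<^sup>2"
  using assms unfolding line_chart_def by blast+

text \<open>On the line of slope m the products of x and y = mx collapse to multiples of m and its
  conjugate (\<open>line1\<close>, \<open>line2\<close>), so F and G enter only through v = F +
  cnj(m) G.\<close>

lemma line_chart_slope:
  "line_chart (\<lambda>x. (x, m \<odot> x)) (\<lambda>f. fst f + oct_cnj m \<odot> snd f)" (is "line_chart ?L ?Q")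
  unfolding line_chart_def
proof (intro conjI allI)
  have line1: "(m \<odot> x) \<odot> oct_cnj x = (norm x)\<^sup>2 *\<^sub>R m" for x
    by (rule oct_mult_cnj_cancel_right)
  have line2: "x \<odot> oct_cnj (m \<odot> x) = (norm x)\<^sup>2 *\<^sub>R oct_cnj m" for x
    by (simp add: oct_cnj_mult oct_mult_cnj_cancel_left)
  show "linear ?L" "linear ?Q"
    by (auto intro!: linearI simp: oct_mult_add algebra_simps)
  have "?Q (v, 0) = v" for v
    by simp
  then show "surj ?Q"
    by (rule surjI)
  show "displacement (f, ?L x) = ?L (x + (norm x)\<^sup>2 *\<^sub>R ?Q f)" for x f
    by (cases f) (simp add: displacement_def line1 line2 oct_mult_add oct_mult_cnj_cancel_left
        norm_oct_mult power_mult_distrib algebra_simps)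
  show "radicand (f, ?L x) = 1 + 2 * (x \<bullet> ?Q f) + (norm x)\<^sup>2 * (norm (?Q f))\<^sup>2" for x f
  proof (cases f)
    case (Pair F G)
    \<comment> \<open>By adjointness the term with four factors becomes the cross term in the
      expansion of the squared norm of v.\<close>
    have "oct_cnj m \<bullet> (F \<odot> oct_cnj G) = F \<bullet> (oct_cnj m \<odot> G)"
      using inner_oct_mult_right[of "oct_cnj m" G F] by (simp add: inner_commute)
    moreover have "(m \<odot> x) \<bullet> G = x \<bullet> (oct_cnj m \<odot> G)"
      by (rule inner_oct_mult_left)
    moreover have "(norm (F + oct_cnj m \<odot> G))\<^sup>2
        = (norm F)\<^sup>2 + 2 * (F \<bullet> (oct_cnj m \<odot> G)) + (norm m)\<^sup>2 * (norm G)\<^sup>2"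
      using dot_norm[of F "oct_cnj m \<odot> G"] by (simp add: norm_oct_mult power_mult_distrib)
    ultimately show ?thesis
      using Pair by (simp add: radicand_def line2 norm_oct_mult
          inner_add_right power_mult_distrib algebra_simps)
  qed
qed

lemma line_chart_vertical: "line_chart (\<lambda>y. (0, y)) snd"
  unfolding line_chart_def
proof (intro conjI allI)
  show "linear (\<lambda>y::octonion. (0::octonion, y))"
    by (auto intro!: linearI)
qed (auto simp: displacement_def radicand_def linear_snd)

lemma line_through:
  assumes "x \<noteq> 0"
  obtains m where "y = m \<odot> x"
proof
  \<comment> \<open>The slope is y times the inverse of x.\<close>
  show "y = ((1 / (norm x)\<^sup>2) *\<^sub>R (y \<odot> oct_cnj x)) \<odot> x"
    using assms oct_mult_cnj_cancel_right[of y "oct_cnj x"] by simp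
qed

lemma line_chart_at:
  obtains L Q x where "line_chart L Q" "p = L x"
proof (cases "fst p = 0")
  case True
  then show ?thesis
    using that[OF line_chart_vertical, of "snd p"] by (simp add: prod_eq_iff)
next
  case False
  then obtain m where "snd p = m \<odot> fst p"
    by (rule line_through)
  then show ?thesis
    using that[OF line_chart_slope, of "fst p" m] by (simp add: prod_eq_iff)
qed

text \<open>By Cauchy-Schwarz the form is at least (1 - |x||v|)^2.\<close>

lemma radicand_form_nonneg:
  "1 + 2 * (x \<bullet> v) + (norm x)\<^sup>2 * (norm v)\<^sup>2 \<ge> 0" for x v :: "'a::real_inner"
proof -
  have "(1 - norm x * norm v)\<^sup>2 \<ge> 0"
    by simp
  then show ?thesis
    using Cauchy_Schwarz_ineq2[of x v] by (simp add: power2_diff power_mult_distrib abs_le_iff)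
qed

text \<open>As \<open>sqrt\<close> is an odd function on the reals, this is what makes
  \<open>rescaling\<close> nonnegative with square \<open>radicand\<close>.\<close>

lemma radicand_nonneg: "radicand g \<ge> 0"
proof -
  obtain L Q x where "line_chart L Q" "snd g = L x"
    by (rule line_chart_at)
  then show ?thesis
    using radicand_form_nonneg by (cases g) (simp add: line_chartD)
qed

lemma rescaling_sq: "(rescaling g)\<^sup>2 = radicand g"
  by (simp add: rescaling_eq radicand_nonneg)

lemma rescaling_nonneg: "rescaling g \<ge> 0"
  by (simp add: rescaling_eq radicand_nonneg)

lemma oh_arrows_iff: "g \<in> oh_arrows \<longleftrightarrow> rescaling g > 0"
  using rescaling_nonneg[of g] by (auto simp: oh_arrows_def)

text \<open>This factorisation is why dividing by \<open>rescaling\<close> restores the norm of x: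
  targets stay on the sphere of their source.\<close>

lemma norm_radicand_form:
  "(norm (x + (norm x)\<^sup>2 *\<^sub>R v))\<^sup>2 = (norm x)\<^sup>2 * (1 + 2 * (x \<bullet> v) + (norm x)\<^sup>2 * (norm v)\<^sup>2)"
  for x v :: "'a::real_inner"
  using dot_norm[of x "(norm x)\<^sup>2 *\<^sub>R v"]
  by (simp add: power_mult_distrib algebra_simps power2_eq_square)

lemma target_in_chart:
  assumes "line_chart L Q"
  shows "oh_target (f, L x) = L ((1 / rescaling (f, L x)) *\<^sub>R (x + (norm x)\<^sup>2 *\<^sub>R Q f))"
  using assms by (simp add: line_chartD linear_scale oh_target_eq)

lemma norm_target_in_chart:
  assumes "line_chart L Q" "(f, L x) \<in> oh_arrows"
  shows "norm ((1 / rescaling (f, L x)) *\<^sub>R (x + (norm x)\<^sup>2 *\<^sub>R Q f)) = norm x"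
proof -
  let ?l = "rescaling (f, L x)"
  have "(norm (x + (norm x)\<^sup>2 *\<^sub>R Q f))\<^sup>2 = (norm x * ?l)\<^sup>2"
    using assms(1) by (simp add: norm_radicand_form power_mult_distrib rescaling_sq line_chartD)
  then have "norm (x + (norm x)\<^sup>2 *\<^sub>R Q f) = norm x * ?l"
    using rescaling_nonneg by simp
  then show ?thesis
    using assms(2) by (simp add: oh_arrows_iff)
qed

text \<open>The target of g lies on the same line as its source, so one chart serves both arrows.
  There the product replaces v by v + l v', and both claims follow from l x' = x + |x|^2 v and |x'|
  = |x|.\<close>

lemma
  assumes "g \<in> oh_arrows" "snd g' = oh_target g"
  shows rescaling_oh_mult: "rescaling (oh_mult (g', g)) = rescaling g' * rescaling g"
    and oh_target_mult: "oh_target (oh_mult (g', g)) = oh_target g'"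
proof -
  obtain f p where g: "g = (f, p)"
    by (cases g)
  obtain L Q x where chart: "line_chart L Q" and p: "p = L x"
    by (rule line_chart_at)
  have lin: "linear Q"
    using chart by (rule line_chartD)
  define l where "l = rescaling g"
  define x' where "x' = (1 / l) *\<^sub>R (x + (norm x)\<^sup>2 *\<^sub>R Q f)"
  obtain f' where g': "g' = (f', L x')"
    using assms target_in_chart[OF chart, of f x]
    by (cases g') (auto simp: x'_def l_def g p)
  have l: "l > 0" "(f, L x) \<in> oh_arrows"
    using assms by (auto simp: oh_arrows_iff l_def g p)
  have norm_x': "norm x' = norm x"
    using norm_target_in_chart[OF chart l(2)] by (simp add: x'_def l_def g p)
  have lx': "l *\<^sub>R x' = x + (norm x)\<^sup>2 *\<^sub>R Q f"
    using l by (simp add: x'_def)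
  have Q: "Q (f + l *\<^sub>R f') = Q f + l *\<^sub>R Q f'"
    using lin by (simp add: linear_add linear_scale)
  have l_sq: "l\<^sup>2 = 1 + 2 * (x \<bullet> Q f) + (norm x)\<^sup>2 * (norm (Q f))\<^sup>2"
    using chart by (simp add: l_def rescaling_sq g p line_chartD(5))
  have inner: "l * (x' \<bullet> Q f') = x \<bullet> Q f' + (norm x)\<^sup>2 * (Q f \<bullet> Q f')"
    using arg_cong[OF lx', of "\<lambda>a. a \<bullet> Q f'"] by (simp add: inner_add_left)
  have norm_sum: "(norm (Q f + l *\<^sub>R Q f'))\<^sup>2
      = (norm (Q f))\<^sup>2 + 2 * l * (Q f \<bullet> Q f') + l\<^sup>2 * (norm (Q f'))\<^sup>2"
    using dot_norm[of "Q f" "l *\<^sub>R Q f'"] by (simp add: power_mult_distrib)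
  have mult: "oh_mult (g', g) = (f + l *\<^sub>R f', L x)"
    by (simp add: oh_mult_eq g g' p l_def)
  have "radicand (oh_mult (g', g)) = l\<^sup>2 + 2 * l * (x \<bullet> Q f' + (norm x)\<^sup>2 * (Q f \<bullet> Q f'))
      + (norm x)\<^sup>2 * (l\<^sup>2 * (norm (Q f'))\<^sup>2)"
    using chart by (simp add: mult line_chartD(5) Q norm_sum l_sq inner_add_right algebra_simps)
  \<comment> \<open>By \<open>inner\<close> the bracket is l <x', v'>, which lets l^2 be factored
    out.\<close>
  also have "\<dots> = l\<^sup>2 * radicand g'"
    unfolding inner[symmetric]
    using chart by (simp add: g' line_chartD(5) norm_x' algebra_simps power2_eq_square)
  finally have "(rescaling (oh_mult (g', g)))\<^sup>2 = (rescaling g' * l)\<^sup>2"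
    by (simp add: rescaling_sq power_mult_distrib)
  then show resc: "rescaling (oh_mult (g', g)) = rescaling g' * rescaling g"
    using rescaling_nonneg by (simp add: l_def power2_eq_iff_nonneg)
  \<comment> \<open>The undivided targets differ by the factor l, exactly the ratio of the two
    rescalings.\<close>
  have "x + (norm x)\<^sup>2 *\<^sub>R Q (f + l *\<^sub>R f') = l *\<^sub>R (x' + (norm x)\<^sup>2 *\<^sub>R Q f')"
    by (simp add: Q lx' algebra_simps)
  then show "oh_target (oh_mult (g', g)) = oh_target g'"
    using resc l chart unfolding mult
    by (simp add: target_in_chart g' norm_x' l_def[symmetric])
qed

section \<open>Units, inverses and the groupoid laws\<close>

lemma rescaling_unit: "rescaling (0, p) = 1"
  by (cases p) (simp add: zero_prod_def)

lemma oh_target_unit: "oh_target (0, p) = p"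
  by (cases p) (simp add: oh_target_eq rescaling_unit, simp add: displacement_def zero_prod_def)

text \<open>No direct computation: g^{-1} g is the unit at the source, so multiplicativity and the
  target law for products give both values.\<close>

lemma
  assumes "g \<in> oh_arrows"
  shows rescaling_oh_inverse: "rescaling (oh_inverse g) = 1 / rescaling g"
    and oh_target_inverse: "oh_target (oh_inverse g) = snd g"
proof -
  have l: "rescaling g > 0"
    using assms by (simp add: oh_arrows_iff)
  have "oh_mult (oh_inverse g, g) = (0, snd g)"
    using l by (simp add: oh_mult_eq oh_inverse_eq)
  moreover have "snd (oh_inverse g) = oh_target g"
    by (simp add: oh_inverse_eq)
  ultimately have "rescaling (0, snd g) = rescaling (oh_inverse g) * rescaling g"
    "oh_target (0, snd g) = oh_target (oh_inverse g)"
    using rescaling_oh_mult[OF assms, of "oh_inverse g"] oh_target_mult[OF assms, of "oh_inverse g"]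
    by simp_all
  then show "rescaling (oh_inverse g) = 1 / rescaling g" "oh_target (oh_inverse g) = snd g"
    using l by (simp_all add: rescaling_unit oh_target_unit field_simps)
qed

lemma oh_inverse_in_arrows: "g \<in> oh_arrows \<Longrightarrow> oh_inverse g \<in> oh_arrows"
  by (simp add: oh_arrows_iff rescaling_oh_inverse)

lemma oh_inverse_inverse: "g \<in> oh_arrows \<Longrightarrow> oh_inverse (oh_inverse g) = g"
  by (simp add: oh_inverse_eq[of "oh_inverse g"] rescaling_oh_inverse oh_target_inverse prod_eq_iff)
    (simp add: oh_inverse_eq oh_arrows_iff)

lemma groupoid_oh: "groupoid UNIV oh_arrows oh_source oh_target oh_mult oh_unit oh_inverse"
proof
  fix g p
  assume g: "g \<in> oh_arrows"
  show "oh_inverse g \<in> oh_arrows"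
    using g by (rule oh_inverse_in_arrows)
  show "oh_mult (g, oh_unit (oh_source g)) = g" "oh_mult (oh_unit (oh_target g), g) = g"
    by (simp_all add: oh_mult_eq oh_unit_eq oh_source_eq rescaling_unit)
  show "oh_source (oh_inverse g) = oh_target g"
    by (simp add: oh_source_eq oh_inverse_eq)
  show "oh_target (oh_inverse g) = oh_source g"
    using g by (simp add: oh_source_eq oh_target_inverse)
  show "oh_mult (oh_inverse g, g) = oh_unit (oh_source g)"
    using g by (simp add: oh_mult_eq oh_inverse_eq oh_source_eq oh_unit_eq oh_arrows_iff)
  show "oh_mult (g, oh_inverse g) = oh_unit (oh_target g)"
    using g by (simp add: oh_mult_eq rescaling_oh_inverse) (simp add: oh_inverse_eq oh_unit_eq)
next
  fix g' g
  assume "(g', g) \<in> composable oh_arrows oh_source oh_target"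
  then have g: "g' \<in> oh_arrows" "g \<in> oh_arrows" "snd g' = oh_target g"
    by (simp_all add: composable_def oh_source_eq)
  show "oh_mult (g', g) \<in> oh_arrows"
    using g by (simp add: oh_arrows_iff rescaling_oh_mult)
  show "oh_source (oh_mult (g', g)) = oh_source g"
    by (simp add: oh_source_eq oh_mult_eq)
  show "oh_target (oh_mult (g', g)) = oh_target g'"
    using g by (simp add: oh_target_mult)
  fix g''
  \<comment> \<open>The coefficient of the first component of g'' is l(g) l(g') on the left and
    l(g'g) on the right, with l the rescaling.\<close>
  show "oh_mult (oh_mult (g'', g'), g) = oh_mult (g'', oh_mult (g', g))"
    using rescaling_oh_mult[OF g(2,3)] by (simp add: oh_mult_eq algebra_simps)
next
  fix p
  show "oh_unit p \<in> oh_arrows" "oh_source (oh_unit p) = p" "oh_target (oh_unit p) = p"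
    by (simp_all add: oh_unit_eq oh_arrows_iff rescaling_unit oh_source_eq oh_target_unit)
qed simp_all

section \<open>Smoothness\<close>

lemma Ck_on_cong:
  assumes "open U" "\<And>x. x \<in> U \<Longrightarrow> f x = g x" "Ck_on n U f"
  shows "Ck_on n U g"
  using assms(2,3)
proof (induction n arbitrary: f g)
  case 0
  then show ?case
    by (simp cong: continuous_on_cong)
next
  case (Suc n)
  have deriv: "(g has_derivative frechet_derivative f (at x)) (at x)" if "x \<in> U" for x
    using has_derivative_transform_within_open[OF _ assms(1) that Suc.prems(1)] Suc.prems(2) that
    by (simp add: frechet_derivative_works)
  then have "frechet_derivative f (at x) = frechet_derivative g (at x)" if "x \<in> U" for x
    using frechet_derivative_at that by blast
  then have "Ck_on n U (\<lambda>x. frechet_derivative g (at x) v)" for v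
    using Suc.IH[of "\<lambda>x. frechet_derivative f (at x) v" "\<lambda>x. frechet_derivative g (at x) v"]
      Suc.prems(2) by simp
  then show ?case
    using deriv by (auto simp: differentiable_def)
qed

text \<open>By uniqueness of derivatives, any explicit derivative may stand in for the chosen
  \<open>frechet_derivative\<close>.\<close>

lemma Ck_on_SucI:
  assumes "open U" "\<And>x. x \<in> U \<Longrightarrow> (f has_derivative f' x) (at x)" "\<And>v. Ck_on n U (\<lambda>x. f' x v)"
  shows "Ck_on (Suc n) U f"
proof -
  have "f' x = frechet_derivative f (at x)" if "x \<in> U" for x
    using assms(2)[OF that] by (rule frechet_derivative_at)
  then have "Ck_on n U (\<lambda>x. frechet_derivative f (at x) v)" for v
    using Ck_on_cong[OF assms(1) _ assms(3)] by simp
  then show ?thesis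
    using assms(2) by (auto simp: differentiable_def)
qed

lemma Ck_on_Suc_has_derivative:
  "Ck_on (Suc n) U f \<Longrightarrow> x \<in> U \<Longrightarrow> (f has_derivative frechet_derivative f (at x)) (at x)"
  by (simp add: frechet_derivative_works)

lemma Ck_on_SucD: "Ck_on (Suc n) U f \<Longrightarrow> Ck_on n U f"
proof (induction n arbitrary: f)
  case 0
  then show ?case
    by (auto intro!: continuous_at_imp_continuous_on differentiable_imp_continuous_within)
next
  case (Suc n)
  then show ?case
    by (metis Ck_on.simps(2))
qed

lemma Ck_on_const: "Ck_on n U (\<lambda>x. c)"
proof (induction n arbitrary: c)
  case (Suc n)
  then show ?case
    by (simp add: frechet_derivative_const)
qed simp

lemma Ck_on_linear:
  assumes "linear f" "open U"
  shows "Ck_on n U f"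
proof -
  have lin: "bounded_linear f"
    using assms(1) by (simp add: linear_conv_bounded_linear)
  show ?thesis
  proof (cases n)
    case 0
    then show ?thesis
      using lin by (simp add: linear_continuous_on)
  next
    case (Suc k)
    then show ?thesis
      using Ck_on_SucI[OF assms(2) bounded_linear_imp_has_derivative[OF lin] Ck_on_const] by simp
  qed
qed

lemma Ck_on_linear_compose:
  assumes "linear h" "open U" "Ck_on n U f"
  shows "Ck_on n U (\<lambda>x. h (f x))"
  using assms(3)
proof (induction n arbitrary: f)
  have lin: "bounded_linear h"
    using assms(1) by (simp add: linear_conv_bounded_linear)
  {
    case 0
    then show ?case
      using linear_continuous_on_compose[OF _ assms(1)] by (simp add: o_def)
  next
    case (Suc n)
    show ?case
    proof (rule Ck_on_SucI[OF assms(2)])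
      show "((\<lambda>x. h (f x)) has_derivative (\<lambda>v. h (frechet_derivative f (at x) v))) (at x)"
        if "x \<in> U" for x
        using bounded_linear.has_derivative[OF lin Ck_on_Suc_has_derivative[OF Suc.prems that]] .
      show "Ck_on n U (\<lambda>x. h (frechet_derivative f (at x) v))" for v
        using Suc by simp
    qed
  }
qed

lemma Ck_on_add:
  assumes "open U" "Ck_on n U f" "Ck_on n U g"
  shows "Ck_on n U (\<lambda>x. f x + g x)"
  using assms(2,3)
proof (induction n arbitrary: f g)
  case 0
  then show ?case
    by (simp add: continuous_on_add)
next
  case (Suc n)
  show ?case
    using Ck_on_SucI[OF assms(1) has_derivative_add[OF Ck_on_Suc_has_derivative[OF Suc.prems(1)]
        Ck_on_Suc_has_derivative[OF Suc.prems(2)]]] Suc by simp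
qed

text \<open>The Leibniz rule pairs a derivative with an undifferentiated factor, so the induction
  varies both functions and \<open>Ck_on_SucD\<close> lowers the order of the latter.\<close>

lemma Ck_on_bilinear:
  assumes "bounded_bilinear h" "open U" "Ck_on n U f" "Ck_on n U g"
  shows "Ck_on n U (\<lambda>x. h (f x) (g x))"
  using assms(3,4)
proof (induction n arbitrary: f g)
  case 0
  then show ?case
    by (simp add: bounded_bilinear.continuous_on[OF assms(1)])
next
  case (Suc n)
  show ?case
  proof (rule Ck_on_SucI[OF assms(2)])
    show "((\<lambda>x. h (f x) (g x)) has_derivative
        (\<lambda>v. h (f x) (frechet_derivative g (at x) v) + h (frechet_derivative f (at x) v) (g x))) (at x)"
      if "x \<in> U" for x
      using Suc.prems that
      by (intro bounded_bilinear.FDERIV[OF assms(1)] Ck_on_Suc_has_derivative)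
    show "Ck_on n U (\<lambda>x. h (f x) (frechet_derivative g (at x) v) + h (frechet_derivative f (at x) v) (g x))" for v
      using Suc.prems Suc.prems[THEN Ck_on_SucD] by (intro Ck_on_add[OF assms(2)] Suc.IH) simp_all
  qed
qed

lemmas Ck_on_scaleR = Ck_on_bilinear[OF bounded_bilinear_scaleR]
lemmas Ck_on_mult = Ck_on_bilinear[OF bounded_bilinear_mult]
lemmas Ck_on_inner = Ck_on_bilinear[OF bounded_bilinear_inner]

text \<open>The derivative is a product of f' with copies of the reciprocal itself, to which the
  induction hypothesis applies.\<close>

lemma Ck_on_inverse:
  fixes f :: "'a::euclidean_space \<Rightarrow> real"
  assumes "open U" "Ck_on n U f" "\<And>x. x \<in> U \<Longrightarrow> f x \<noteq> 0"
  shows "Ck_on n U (\<lambda>x. inverse (f x))"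
  using assms(2)
proof (induction n)
  case 0
  then show ?case
    using assms(3) by (simp add: continuous_on_inverse)
next
  case (Suc n)
  show ?case
  proof (rule Ck_on_SucI[OF assms(1)])
    show "((\<lambda>x. inverse (f x)) has_derivative
        (\<lambda>v. (inverse (f x) * frechet_derivative f (at x) v * inverse (f x)) * -1)) (at x)"
      if "x \<in> U" for x
      using Deriv.has_derivative_inverse[OF assms(3)[OF that] Ck_on_Suc_has_derivative[OF Suc.prems that]]
      by simp
    show "Ck_on n U (\<lambda>x. (inverse (f x) * frechet_derivative f (at x) v * inverse (f x)) * -1)" for v
      using Suc.prems Suc.IH[OF Ck_on_SucD[OF Suc.prems]]
      by (intro Ck_on_mult assms(1) Ck_on_const) simp_all
  qed
qed

text \<open>The derivative is f' over twice the root. The induction hypothesis covers the root and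
  \<open>Ck_on_inverse\<close> its reciprocal.\<close>

lemma Ck_on_sqrt:
  fixes f :: "'a::euclidean_space \<Rightarrow> real"
  assumes "open U" "Ck_on n U f" "\<And>x. x \<in> U \<Longrightarrow> f x > 0"
  shows "Ck_on n U (\<lambda>x. sqrt (f x))"
  using assms(2)
proof (induction n)
  case 0
  then show ?case
    by (simp add: continuous_on_real_sqrt)
next
  case (Suc n)
  have pos: "sqrt (f x) \<noteq> 0" if "x \<in> U" for x
    using assms(3)[OF that] by simp
  show ?case
  proof (rule Ck_on_SucI[OF assms(1)])
    show "((\<lambda>x. sqrt (f x)) has_derivative
        (\<lambda>v. frechet_derivative f (at x) v * (inverse (sqrt (f x)) / 2))) (at x)"
      if "x \<in> U" for x
      using has_derivative_real_sqrt[OF assms(3)[OF that] Ck_on_Suc_has_derivative[OF Suc.prems that]]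
      by simp
    show "Ck_on n U (\<lambda>x. frechet_derivative f (at x) v * (inverse (sqrt (f x)) / 2))" for v
      unfolding divide_inverse
      using Suc.prems Suc.IH[OF Ck_on_SucD[OF Suc.prems]] pos
      by (intro Ck_on_mult Ck_on_inverse assms(1) Ck_on_const) simp_all
  qed
qed

lemma Ck_on_Pair:
  assumes "open U" "Ck_on n U f" "Ck_on n U g"
  shows "Ck_on n U (\<lambda>x. (f x, g x))"
proof -
  have "linear (\<lambda>a::'b. (a, 0::'c))" "linear (\<lambda>b::'c. (0::'b, b))"
    by (auto intro!: linearI)
  \<comment> \<open>A pair is the sum of its images under the two linear embeddings.\<close>
  then have "Ck_on n U (\<lambda>x. (f x, 0) + (0, g x))"
    using assms by (intro Ck_on_add Ck_on_linear_compose[where h = "\<lambda>a. (a, 0)"]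
        Ck_on_linear_compose[where h = "\<lambda>b. (0, b)"])
  then show ?thesis
    by simp
qed

lemma smooth_map_onI:
  assumes "open U" "S \<subseteq> U" "\<And>n. Ck_on n U f"
  shows "smooth_map_on S f"
  unfolding smooth_map_on_def using assms by blast

lemma Ck_on_ident: "open U \<Longrightarrow> Ck_on n U (\<lambda>x. x)"
  by (rule Ck_on_linear) (simp_all add: linear_ident)

lemmas Ck_on_fst = Ck_on_linear_compose[OF linear_fst]
lemmas Ck_on_snd = Ck_on_linear_compose[OF linear_snd]
lemmas Ck_on_oct_cnj = Ck_on_linear_compose[OF linear_oct_cnj]
lemmas Ck_on_oct_mult = Ck_on_bilinear[OF bilinear_oct_mult[unfolded bilinear_conv_bounded_bilinear]]

lemmas Ck_on_intros = Ck_on_const Ck_on_ident Ck_on_fst Ck_on_snd Ck_on_oct_cnj Ck_on_oct_mult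
  Ck_on_add Ck_on_scaleR Ck_on_mult Ck_on_inner Ck_on_Pair

section \<open>Smoothness of the structure maps and the submersion property\<close>

lemma Ck_on_radicand:
  assumes "open U" "Ck_on n U f"
  shows "Ck_on n U (\<lambda>x. radicand (f x))"
  unfolding radicand_def case_prod_unfold power2_norm_eq_inner
  using assms by (intro Ck_on_intros)

lemma Ck_on_displacement:
  assumes "open U" "Ck_on n U f"
  shows "Ck_on n U (\<lambda>x. displacement (f x))"
  unfolding displacement_def case_prod_unfold power2_norm_eq_inner
  using assms by (intro Ck_on_intros)

lemma Ck_on_rescaling:
  assumes "open U" "Ck_on n U f" "\<And>x. x \<in> U \<Longrightarrow> f x \<in> oh_arrows"
  shows "Ck_on n U (\<lambda>x. rescaling (f x))"
  unfolding rescaling_eq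
proof (rule Ck_on_sqrt[OF assms(1) Ck_on_radicand[OF assms(1,2)]])
  show "radicand (f x) > 0" if "x \<in> U" for x
    using assms(3)[OF that] by (simp add: oh_arrows_iff rescaling_eq)
qed

lemma open_oh_arrows: "open oh_arrows"
proof -
  have "continuous_on UNIV radicand"
    using Ck_on_radicand[OF open_UNIV Ck_on_ident, of 0] by simp
  then have "open {g. radicand g \<noteq> 0}"
    by (intro open_Collect_neq continuous_on_const)
  then show ?thesis
    by (simp add: oh_arrows_def rescaling_eq)
qed

lemma Ck_on_oh_target: "Ck_on n oh_arrows oh_target"
proof -
  have "Ck_on n oh_arrows (\<lambda>g. inverse (rescaling g) *\<^sub>R displacement g)"
    using open_oh_arrows by (intro Ck_on_scaleR Ck_on_inverse Ck_on_rescaling Ck_on_displacement Ck_on_ident)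
      (simp_all add: oh_arrows_def)
  moreover have "oh_target = (\<lambda>g. inverse (rescaling g) *\<^sub>R displacement g)"
    by (simp add: fun_eq_iff oh_target_eq inverse_eq_divide)
  ultimately show ?thesis
    by simp
qed

lemma Ck_on_oh_inverse: "Ck_on n oh_arrows oh_inverse"
proof -
  have "Ck_on n oh_arrows (\<lambda>g. ((inverse (rescaling g) * -1) *\<^sub>R fst g, oh_target g))"
    using open_oh_arrows
    by (intro Ck_on_Pair Ck_on_oh_target Ck_on_scaleR Ck_on_mult Ck_on_const Ck_on_inverse
        Ck_on_rescaling Ck_on_fst Ck_on_ident) (simp_all add: oh_arrows_def)
  moreover have "oh_inverse = (\<lambda>g. ((inverse (rescaling g) * -1) *\<^sub>R fst g, oh_target g))"
    by (simp add: fun_eq_iff oh_inverse_eq inverse_eq_divide)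
  ultimately show ?thesis
    by simp
qed

text \<open>The formula for the product is smooth on an open set containing all composable pairs,
  which is the extension that \<open>smooth_map_on\<close> asks for.\<close>

lemma Ck_on_oh_mult: "Ck_on n (UNIV \<times> oh_arrows) oh_mult"
proof -
  have U: "open (UNIV \<times> oh_arrows :: (oct_arrow \<times> oct_arrow) set)"
    using open_oh_arrows by (intro open_Times open_UNIV)
  have "Ck_on n (UNIV \<times> oh_arrows)
      (\<lambda>z :: oct_arrow \<times> oct_arrow. (fst (snd z) + rescaling (snd z) *\<^sub>R fst (fst z), snd (snd z)))"
    using U by (intro Ck_on_Pair Ck_on_add Ck_on_scaleR Ck_on_rescaling Ck_on_fst Ck_on_snd Ck_on_ident)
      auto
  moreover have "oh_mult = (\<lambda>z. (fst (snd z) + rescaling (snd z) *\<^sub>R fst (fst z), snd (snd z)))"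
    by (simp add: fun_eq_iff oh_mult_eq)
  ultimately show ?thesis
    by simp
qed

text \<open>The inversion is a diffeomorphism, so its derivative is onto.\<close>

lemma submersion_oh_target: "submersion_on oh_arrows oh_target"
  unfolding submersion_on_def
proof (intro ballI exI conjI)
  fix g
  assume g: "g \<in> oh_arrows"
  define g' where "g' = oh_inverse g"
  have g': "g' \<in> oh_arrows" "oh_inverse g' = g"
    using g by (simp_all add: g'_def oh_inverse_in_arrows oh_inverse_inverse)
  define D where "D h = frechet_derivative oh_inverse (at h)" for h
  have D: "(oh_inverse has_derivative D h) (at h)" if "h \<in> oh_arrows" for h
    unfolding D_def using Ck_on_oh_inverse that by (rule Ck_on_Suc_has_derivative)
  \<comment> \<open>The chain rule is applied at \<open>g'\<close>, so that \<open>D g\<close> is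
    the outer factor and inherits surjectivity from the identity.\<close>
  have "((oh_inverse \<circ> oh_inverse) has_derivative (D g \<circ> D g')) (at g')"
    using diff_chain_at[OF D[OF g'(1)]] D[OF g] by (simp add: g'(2))
  then have "((\<lambda>h. h) has_derivative (D g \<circ> D g')) (at g')"
    by (rule has_derivative_transform_within_open[OF _ open_oh_arrows g'(1)])
      (simp add: oh_inverse_inverse)
  then have "D g \<circ> D g' = (\<lambda>h. h)"
    using has_derivative_unique has_derivative_ident by blast
  then have "surj (D g)"
    by (metis comp_apply surjI)
  then show "surj (snd \<circ> D g)"
    using range_snd by (rule comp_surj)
  have "oh_target = (\<lambda>g. snd (oh_inverse g))"
    by (simp add: fun_eq_iff oh_inverse_eq)
  then show "(oh_target has_derivative snd \<circ> D g) (at g)"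
    using has_derivative_snd[OF D[OF g]] by (simp add: o_def)
qed

lemma lie_groupoid_oh: "lie_groupoid UNIV oh_arrows oh_source oh_target oh_mult oh_unit oh_inverse"
proof (intro lie_groupoid.intro lie_groupoid_axioms.intro groupoid_oh open_oh_arrows open_UNIV
    submersion_oh_target)
  have source: "oh_source = snd"
    by (simp add: fun_eq_iff oh_source_eq)
  show "smooth_map_on oh_arrows oh_source"
    unfolding source by (rule smooth_map_onI[OF open_UNIV]) (simp_all add: Ck_on_linear linear_snd)
  show "submersion_on oh_arrows oh_source"
    unfolding source submersion_on_def
    by (auto intro!: exI[of _ snd] bounded_linear_imp_has_derivative bounded_linear_snd range_snd)
  show "smooth_map_on oh_arrows oh_target" "smooth_map_on oh_arrows oh_inverse"
    using open_oh_arrows Ck_on_oh_target Ck_on_oh_inverse by (auto intro: smooth_map_onI)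
  have "composable oh_arrows oh_source oh_target \<subseteq> UNIV \<times> oh_arrows"
    by (auto simp: composable_def)
  then show "smooth_map_on (composable oh_arrows oh_source oh_target) oh_mult"
    using open_oh_arrows by (intro smooth_map_onI[OF _ _ Ck_on_oh_mult] open_Times open_UNIV)
  have "linear oh_unit"
    by (auto intro!: linearI simp: oh_unit_eq)
  then show "smooth_map_on UNIV oh_unit"
    by (intro smooth_map_onI[OF open_UNIV]) (simp_all add: Ck_on_linear)
qed

section \<open>Equivariance\<close>

lemma norm_oct_one [simp]: "norm oct_one = 1"
  by (simp add: oct_one_def oct_basis_def norm_axis_1)

lemma G2_one:
  assumes "\<phi> \<in> G2"
  shows "\<phi> oct_one = oct_one"
proof -
  \<comment> \<open>The image of the unit is a left unit for every image, in particular for the unit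
    itself.\<close>
  obtain e where e: "\<phi> e = oct_one"
    using assms unfolding G2_def by (metis (mono_tags, lifting) bij_pointE mem_Collect_eq)
  have "\<phi> (oct_one \<odot> e) = \<phi> oct_one \<odot> \<phi> e"
    using assms unfolding G2_def by blast
  then show ?thesis
    using e by simp
qed

text \<open>The quadratic equation \<open>oct_square\<close> determines real part and norm of a non-real octonion.\<close>

lemma
  assumes "\<phi> \<in> G2"
  shows G2_inner_one: "\<phi> x \<bullet> oct_one = x \<bullet> oct_one"
    and G2_norm: "norm (\<phi> x) = norm x"
proof -
  have lin: "linear \<phi>" and inj: "inj \<phi>" and mult: "\<phi> (a \<odot> b) = \<phi> a \<odot> \<phi> b" for a b
    using assms by (auto simp: G2_def bij_is_inj)
  have real: "\<phi> (c *\<^sub>R oct_one) = c *\<^sub>R oct_one" for c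
    using lin G2_one[OF assms] by (simp add: linear_scale)
  have "\<phi> x \<bullet> oct_one = x \<bullet> oct_one \<and> norm (\<phi> x) = norm x"
  \<comment> \<open>Real octonions satisfy many quadratic equations, so they are treated apart,
    through \<open>real\<close>.\<close>
  proof (cases "\<exists>c. x = c *\<^sub>R oct_one")
    case True
    then show ?thesis
      using real by auto
  next
    case False
    define a where "a = 2 * (\<phi> x \<bullet> oct_one) - 2 * (x \<bullet> oct_one)"
    define b where "b = (norm (\<phi> x))\<^sup>2 - (norm x)\<^sup>2"
    have "\<phi> (x \<odot> x) = (2 * (x \<bullet> oct_one)) *\<^sub>R \<phi> x - (norm x)\<^sup>2 *\<^sub>R oct_one"
      using lin by (simp add: oct_square linear_diff linear_scale G2_one[OF assms])
    moreover have "\<phi> (x \<odot> x) = (2 * (\<phi> x \<bullet> oct_one)) *\<^sub>R \<phi> x - (norm (\<phi> x))\<^sup>2 *\<^sub>R oct_one"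
      unfolding mult by (rule oct_square)
    ultimately have ab: "a *\<^sub>R \<phi> x = b *\<^sub>R oct_one"
      by (simp add: a_def b_def algebra_simps)
    \<comment> \<open>Otherwise the image of x would be real, and by injectivity x as well.\<close>
    have "a = 0"
    proof (rule ccontr)
      assume "a \<noteq> 0"
      then have "\<phi> x = (1 / a) *\<^sub>R (a *\<^sub>R \<phi> x)"
        by simp
      also have "\<dots> = \<phi> ((b / a) *\<^sub>R oct_one)"
        unfolding ab real by simp
      finally show False
        using inj False by (auto dest: injD)
    qed
    moreover from this have "b = 0"
      using ab norm_oct_one by (metis norm_zero scaleR_eq_0_iff zero_neq_one)
    ultimately show ?thesis
      by (simp add: a_def b_def)
  qed
  then show "\<phi> x \<bullet> oct_one = x \<bullet> oct_one" "norm (\<phi> x) = norm x"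
    by simp_all
qed

text \<open>Polarisation of \<open>G2_norm\<close>.\<close>

lemma G2_inner:
  assumes "\<phi> \<in> G2"
  shows "\<phi> x \<bullet> \<phi> y = x \<bullet> y"
proof -
  have "\<phi> x + \<phi> y = \<phi> (x + y)"
    using assms by (simp add: G2_def linear_add)
  then show ?thesis
    by (simp only: dot_norm G2_norm[OF assms])
qed

lemma G2_cnj:
  assumes "\<phi> \<in> G2"
  shows "\<phi> (oct_cnj x) = oct_cnj (\<phi> x)"
proof -
  have "linear \<phi>"
    using assms by (simp add: G2_def)
  then show ?thesis
    by (simp add: oct_cnj_def linear_diff linear_scale G2_one[OF assms] G2_inner_one[OF assms])
qed

lemma G2_equivariant_oh:
  "G2_equivariant UNIV oh_arrows oh_source oh_target oh_mult oh_unit oh_inverse"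
  unfolding G2_equivariant_def
proof (rule ballI)
  fix \<phi> assume \<phi>: "\<phi> \<in> G2"
  have lin: "linear \<phi>" and surj: "surj \<phi>" and mult: "\<phi> a \<odot> \<phi> b = \<phi> (a \<odot> b)" for a b
    using \<phi> by (auto simp: G2_def bij_is_surj)
  \<comment> \<open>Oriented to pull the automorphism out of products and conjugates until an inner
    product or norm absorbs it.\<close>
  note hom = mult G2_cnj[OF \<phi>, symmetric] G2_inner[OF \<phi>] G2_norm[OF \<phi>]
  have surj_point: "surj (G2_point \<phi>)" and surj_arrow: "surj (G2_arrow \<phi>)"
    using surj by (simp_all add: G2_point_def G2_arrow_def map_prod_surj)
  have lin_point: "linear (G2_point \<phi>)"
    using lin by (auto intro!: linearI simp: G2_point_def linear_add linear_scale)
  have fst_snd: "fst (G2_arrow \<phi> g) = G2_point \<phi> (fst g)"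
    "snd (G2_arrow \<phi> g) = G2_point \<phi> (snd g)" for g
    by (simp_all add: G2_arrow_def)
  have arrow_Pair: "G2_arrow \<phi> (f, p) = (G2_point \<phi> f, G2_point \<phi> p)" for f p
    by (simp add: G2_arrow_def)
  have "radicand (G2_arrow \<phi> g) = radicand g" for g
    by (cases g rule: rescaling.cases) (simp add: radicand_def G2_arrow_def G2_point_def hom)
  then have rescaling: "rescaling (G2_arrow \<phi> g) = rescaling g" for g
    by (simp add: rescaling_eq)
  have "displacement (G2_arrow \<phi> g) = G2_point \<phi> (displacement g)" for g
    using lin by (cases g rule: rescaling.cases)
      (simp add: displacement_def G2_arrow_def G2_point_def hom linear_add linear_scale)
  then have target: "oh_target (G2_arrow \<phi> g) = G2_point \<phi> (oh_target g)" for g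
    using lin_point by (simp add: oh_target_eq rescaling linear_scale)
  have "G2_arrow \<phi> ` oh_arrows = oh_arrows"
  proof
    show "G2_arrow \<phi> ` oh_arrows \<subseteq> oh_arrows"
      by (auto simp: oh_arrows_def rescaling)
    show "oh_arrows \<subseteq> G2_arrow \<phi> ` oh_arrows"
    proof
      fix g assume "g \<in> oh_arrows"
      moreover obtain g0 where "g = G2_arrow \<phi> g0"
        using surj_arrow by blast
      ultimately show "g \<in> G2_arrow \<phi> ` oh_arrows"
        by (simp add: oh_arrows_def rescaling)
    qed
  qed
  moreover have "oh_mult (G2_arrow \<phi> g', G2_arrow \<phi> g) = G2_arrow \<phi> (oh_mult (g', g))" for g' g
    using lin_point by (simp add: oh_mult_eq fst_snd arrow_Pair rescaling linear_add linear_scale)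
  moreover have "oh_inverse (G2_arrow \<phi> g) = G2_arrow \<phi> (oh_inverse g)" for g
    using linear_scale[OF lin_point, of "- (1 / rescaling g)" "fst g"]
    by (simp add: oh_inverse_eq fst_snd arrow_Pair rescaling target)
  moreover have "oh_unit (G2_point \<phi> p) = G2_arrow \<phi> (oh_unit p)" for p
    using lin_point by (simp add: oh_unit_eq arrow_Pair linear_0)
  ultimately show "G2_point \<phi> ` UNIV = UNIV \<and> G2_arrow \<phi> ` oh_arrows = oh_arrows \<and>
      (\<forall>g\<in>oh_arrows. oh_source (G2_arrow \<phi> g) = G2_point \<phi> (oh_source g)) \<and>
      (\<forall>g\<in>oh_arrows. oh_target (G2_arrow \<phi> g) = G2_point \<phi> (oh_target g)) \<and>
      (\<forall>(g', g)\<in>composable oh_arrows oh_source oh_target.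
         oh_mult (G2_arrow \<phi> g', G2_arrow \<phi> g) = G2_arrow \<phi> (oh_mult (g', g))) \<and>
      (\<forall>p\<in>UNIV. oh_unit (G2_point \<phi> p) = G2_arrow \<phi> (oh_unit p)) \<and>
      (\<forall>g\<in>oh_arrows. oh_inverse (G2_arrow \<phi> g) = G2_arrow \<phi> (oh_inverse g))"
    using surj_point target by (auto simp: oh_source_eq fst_snd)
qed

section \<open>Orbits\<close>

lemma orbit_in_chart:
  assumes chart: "line_chart L Q"
  shows "{(oh_source g, oh_target g) | g. g \<in> oh_arrows} `` {L x} = L ` {w. norm w = norm x}"
    (is "?R `` _ = _")
proof (intro equalityI subsetI)
  fix q assume "q \<in> ?R `` {L x}"
  then obtain f where g: "(f, L x) \<in> oh_arrows" "q = oh_target (f, L x)"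
    by (auto simp: oh_source_eq)
  then show "q \<in> L ` {w. norm w = norm x}"
    using norm_target_in_chart[OF chart g(1)] by (auto simp: target_in_chart[OF chart])
next
  fix q assume "q \<in> L ` {w. norm w = norm x}"
  then obtain w where w: "norm w = norm x" "q = L w"
    by blast
  \<comment> \<open>Solves x + |x|^2 Q f = w, using that Q is onto. For x = 0 the quotient is 0 by
    convention and w = 0.\<close>
  obtain f where f: "Q f = (1 / (norm x)\<^sup>2) *\<^sub>R (w - x)"
    using line_chartD(3)[OF chart] by (metis surjD)
  have shift: "x + (norm x)\<^sup>2 *\<^sub>R Q f = w"
    using w by (cases "x = 0") (simp_all add: f)
  \<comment> \<open>Equal norms of x and w force the radicand to be 1 when x is nonzero; for x = 0
    it is 1 by its formula.\<close>
  then have "(norm x)\<^sup>2 * radicand (f, L x) = (norm x)\<^sup>2"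
    using norm_radicand_form[of x "Q f"] w(1) by (simp add: line_chartD(5)[OF chart])
  then have "radicand (f, L x) = 1"
    by (cases "x = 0") (simp_all add: line_chartD(5)[OF chart])
  then have "rescaling (f, L x) = 1"
    by (simp add: rescaling_eq)
  then have "(f, L x) \<in> oh_arrows" "(L x, q) = (oh_source (f, L x), oh_target (f, L x))"
    using w(2) shift by (simp_all add: oh_arrows_iff oh_source_eq target_in_chart[OF chart])
  then have "(L x, q) \<in> ?R"
    by blast
  then show "q \<in> ?R `` {L x}"
    by blast
qed

text \<open>Since |mx| = |m||x|, the chart scales norms by the constant sqrt(1 + |m|^2).\<close>

lemma oct_line_sphere:
  assumes "r \<ge> 0"
  shows "oct_line m \<inter> oct_sphere r = (\<lambda>x. (x, m \<odot> x)) ` {x. norm x = r / sqrt (1 + (norm m)\<^sup>2)}"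
proof -
  have pos: "1 + (norm m)\<^sup>2 > 0"
    by (simp add: add_pos_nonneg)
  have "(norm x)\<^sup>2 + (norm (m \<odot> x))\<^sup>2 = r\<^sup>2 \<longleftrightarrow> norm x = r / sqrt (1 + (norm m)\<^sup>2)" for x
  proof -
    have "(norm x)\<^sup>2 + (norm (m \<odot> x))\<^sup>2 = (norm x * sqrt (1 + (norm m)\<^sup>2))\<^sup>2"
      using pos by (simp add: norm_oct_mult power_mult_distrib algebra_simps)
    then have "(norm x)\<^sup>2 + (norm (m \<odot> x))\<^sup>2 = r\<^sup>2 \<longleftrightarrow> norm x * sqrt (1 + (norm m)\<^sup>2) = r"
      using assms pos by (simp add: power2_eq_iff_nonneg)
    then show ?thesis
      using pos by (simp add: eq_divide_eq)
  qed
  then show ?thesis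
    by (auto simp: oct_line_def oct_sphere_def)
qed

lemma oct_line_inf_sphere:
  assumes "r \<ge> 0"
  shows "oct_line_inf \<inter> oct_sphere r = (\<lambda>y. (0, y)) ` {y. norm y = r}"
  using assms by (auto simp: oct_line_inf_def oct_sphere_def power2_eq_iff_nonneg)

lemma orbits_oh: "groupoid_orbits UNIV oh_arrows oh_source oh_target = OH_leaves"
proof -
  define R where "R = {(oh_source g, oh_target g) | g. g \<in> oh_arrows}"
  have orbits: "groupoid_orbits UNIV oh_arrows oh_source oh_target = range (\<lambda>p. R `` {p})"
    by (auto simp: groupoid_orbits_def R_def quotient_def)
  have orbit_slope: "R `` {(x, m \<odot> x)}
      = oct_line m \<inter> oct_sphere (norm x * sqrt (1 + (norm m)\<^sup>2))" for x m
  proof -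
    have "sqrt (1 + (norm m)\<^sup>2) \<noteq> 0"
      by (smt (verit) real_sqrt_eq_zero_cancel_iff zero_le_power2)
    then show ?thesis
      using orbit_in_chart[OF line_chart_slope] by (simp add: R_def oct_line_sphere)
  qed
  have orbit_vertical: "R `` {(0, y)} = oct_line_inf \<inter> oct_sphere (norm y)" for y
    using orbit_in_chart[OF line_chart_vertical] by (simp add: R_def oct_line_inf_sphere)
  have sqrt_pos: "sqrt (1 + (norm m)\<^sup>2) > 0" for m :: octonion
    by (simp add: add_pos_nonneg)
  \<comment> \<open>The vertical orbit of radius 0 is the leaf that the families with r > 0
    omit.\<close>
  have origin: "oct_line_inf \<inter> oct_sphere 0 = {(0, 0)}"
    by (simp add: oct_line_inf_sphere)
  show ?thesis
    unfolding orbits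
  proof (intro equalityI subsetI)
    fix A assume "A \<in> range (\<lambda>p. R `` {p})"
    then obtain x y where A: "A = R `` {(x, y)}"
      by auto
    show "A \<in> OH_leaves"
    proof (cases "x = 0")
      case True
      then show ?thesis
        using A origin by (cases "y = 0") (auto simp: orbit_vertical OH_leaves_def)
    next
      case False
      then obtain m where "y = m \<odot> x"
        by (rule line_through)
      then have "A = oct_line m \<inter> oct_sphere (norm x * sqrt (1 + (norm m)\<^sup>2))"
        by (simp add: A orbit_slope)
      moreover have "norm x * sqrt (1 + (norm m)\<^sup>2) > 0"
        using False sqrt_pos by simp
      ultimately show ?thesis
        unfolding OH_leaves_def by blast
    qed
  next
    fix A assume "A \<in> OH_leaves"
    then consider m r where "r > 0" "A = oct_line m \<inter> oct_sphere r"
      | r where "r > 0" "A = oct_line_inf \<inter> oct_sphere r" | "A = {(0, 0)}"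
      unfolding OH_leaves_def by blast
    then show "A \<in> range (\<lambda>p. R `` {p})"
    proof cases
      case 1
      \<comment> \<open>Any x of this norm would do: it puts (x, mx) on the sphere of radius
        r.\<close>
      define x where "x = (r / sqrt (1 + (norm m)\<^sup>2)) *\<^sub>R oct_one"
      have "norm x * sqrt (1 + (norm m)\<^sup>2) = r"
        using 1 sqrt_pos[of m] by (simp add: x_def)
      then have "A = R `` {(x, m \<odot> x)}"
        by (simp only: orbit_slope 1)
      then show ?thesis
        by blast
    next
      case 2
      then have "A = R `` {(0, r *\<^sub>R oct_one)}"
        by (simp add: orbit_vertical)
      then show ?thesis
        by blast
    next
      case 3
      then have "A = R `` {(0, 0)}"
        using origin by (simp add: orbit_vertical)
      then show ?thesis
        by blast
    qed
  qed
qed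

theorem theorem3:
  shows "lie_groupoid UNIV oh_arrows oh_source oh_target oh_mult oh_unit oh_inverse
    \<and> G2_equivariant UNIV oh_arrows oh_source oh_target oh_mult oh_unit oh_inverse
    \<and> groupoid_orbits UNIV oh_arrows oh_source oh_target = OH_leaves"
  using lie_groupoid_oh G2_equivariant_oh orbits_oh by blast

end
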